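(* Let $\delta\in(0,1)$ and let $M_r\in\mathbb{R}^{\rho_r\times p}$, $M_c\in\mathbb{R}^{n\times\rho_c}$ be subsampling matrices such that $$(1-\delta)\,\|Y\|_F^2\le\frac{np}{\rho_r\rho_c}\,\|M_rYM_c\|_F^2\le(1+\delta)\,\|Y\|_F^2\quad\text{for all }Y\in\mathcal{LR}(P_{k_r},Q_{k_c}).$$ Let $\gamma_r',\gamma_c'>0$ and assume $\lambda_{k_r+1}>0$, $\lambda_{k_c+1}>0$. Let $\bar U\in\mathbb{R}^{p\times k}$ have all columns in $\mathrm{span}(P_{k_r})$, let $\bar V\in\mathbb{R}^{n\times k}$ have all columns in $\mathrm{span}(Q_{k_c})$, let $\tilde E^u\in\mathbb{R}^{\rho_r\times k}$, $\tilde E^v\in\mathbb{R}^{\rho_c\times k}$, and set $\tilde U=M_r\bar U+\tilde E^u$, $\tilde V=M_c^\top\bar V+\tilde E^v$. Let $U^*$ and $V^*$ be solutions of $$\min_{U\in\mathbb{R}^{p\times k}}\|M_rU-\tilde U\|_F^2+\gamma_r'\,\mathrm{tr}(U^\top\mathcal{L}_rU)\qquad\text{and}\qquad\min_{V\in\mathbb{R}^{n\times k}}\|M_c^\top V-\tilde V\|_F^2+\gamma_c'\,\mathrm{tr}(V^\top\mathcal{L}_cV),$$ respectively. Put $\bar U^*=P_{k_r}P_{k_r}^\top U^*$, $E^*_u=U^*-\bar U^*$, $\bar V^*=Q_{k_c}Q_{k_c}^\top V^*$, $E^*_v=V^*-\bar V^*$. Then $$\|\bar U^*-\bar U\|_F\le\sqrt{\frac{2p}{\rho_r(1-\delta)}}\left[\left(2+\frac{1}{\sqrt{\gamma_r'\lambda_{k_r+1}}}\right)\|\tilde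 E^u\|_F+\left(\sqrt{\frac{\lambda_{k_r}}{\lambda_{k_r+1}}}+\sqrt{\gamma_r'\lambda_{k_r}}\right)\|\bar U\|_F\right],$$ $$\|E^*_u\|_F\le\sqrt{\frac{2}{\gamma_r'\lambda_{k_r+1}}}\,\|\tilde E^u\|_F+\sqrt{2\frac{\lambda_{k_r}}{\lambda_{k_r+1}}}\,\|\bar U\|_F,$$ and likewise $$\|\bar V^*-\bar V\|_F\le\sqrt{\frac{2n}{\rho_c(1-\delta)}}\left[\left(2+\frac{1}{\sqrt{\gamma_c'\lambda_{k_c+1}}}\right)\|\tilde E^v\|_F+\left(\sqrt{\frac{\lambda_{k_c}}{\lambda_{k_c+1}}}+\sqrt{\gamma_c'\lambda_{k_c}}\right)\|\bar V\|_F\right],$$ $$\|E^*_v\|_F\le\sqrt{\frac{2}{\gamma_c'\lambda_{k_c+1}}}\,\|\tilde E^v\|_F+\sqrt{2\frac{\lambda_{k_c}}{\lambda_{k_c+1}}}\,\|\bar V\|_F.$$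
   Context: $\mathcal{L}_c\in\mathbb{R}^{n\times n}$ and $\mathcal{L}_r\in\mathbb{R}^{p\times p}$ are Laplacians of two undirected graphs with nonnegative weights (on the columns and on the rows of $p\times n$ data matrices). Write $\mathcal{L}_c=Q\Lambda_cQ^\top$, $\mathcal{L}_r=P\Lambda_rP^\top$ with $Q,P$ orthogonal and eigenvalues sorted in increasing order; $Q_{k_c}\in\mathbb{R}^{n\times k_c}$ and $P_{k_r}\in\mathbb{R}^{p\times k_r}$ consist of the first $k_c$ columns of $Q$ and the first $k_r$ columns of $P$, with $k_c<n$, $k_r<p$. The symbols $\lambda_{k_c},\lambda_{k_c+1}$ denote the $k_c$-th and $(k_c+1)$-th smallest eigenvalues of $\mathcal{L}_c$, and $\lambda_{k_r},\lambda_{k_r+1}$ denote the $k_r$-th and $(k_r+1)$-th smallest eigenvalues of $\mathcal{L}_r$ (the subscript indicates which Laplacian is meant). $k\ge1$ is the number of columns of the matrices $U,V$. $\mathcal{LR}(P_{k_r},Q_{k_c})$ is the set of matrices $Y\in\mathbb{R}^{p\times n}$ all of whose columns lie in $\mathrm{span}(P_{k_r})$ and all of whose rows (viewed as vectors of $\mathbb{R}^n$) lie in $\mathrm{span}(Q_{k_c})$, where span of a matrix means the span of its columns. Subsampling matrices: for distinct indices $\omega_1,\dots,\omega_{\rho_c}\in\{1,\dots,n\}$, $(M_c)_{ij}=1$ if $i=\omega_j$ and $0$ otherwise; for distinct indices $\omega_1,\dots,\omega_{\rho_r}\in\{1,\dots,p\}$, $(M_r)_{ij}=1$ if $j=\omega_i$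 and $0$ otherwise. $\|\cdot\|_F$ is the Frobenius norm. *)

theory Defs
  imports Complex_Main "Jordan_Normal_Form.VS_Connect"
begin

definition frob_norm :: "real mat \<Rightarrow> real" where
  "frob_norm A = sqrt (\<Sum>i<dim_row A. \<Sum>j<dim_col A. (A $$ (i,j))\<^sup>2)"

definition mat_trace :: "real mat \<Rightarrow> real" where
  "mat_trace A = (\<Sum>i<dim_row A. A $$ (i,i))"

abbreviation mat_span :: "real mat \<Rightarrow> real vec set" where
  "mat_span A \<equiv> vec_space.col_space (dim_row A) A"

(* Combinatorial Laplacian D - W. Loops are not excluded: diagonal entries of W cancel. *)
definition weight_matrix :: "nat \<Rightarrow> real mat \<Rightarrow> bool" where
  "weight_matrix n W \<longleftrightarrow> W \<in> carrier_mat n n \<and> W\<^sup>T = W \<and>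
     (\<forall>i<n. \<forall>j<n. 0 \<le> W $$ (i,j))"

definition degree_matrix :: "real mat \<Rightarrow> real mat" where
  "degree_matrix W = mat_diag (dim_row W) (\<lambda>i. \<Sum>j<dim_col W. W $$ (i,j))"

definition graph_laplacian :: "nat \<Rightarrow> real mat \<Rightarrow> bool" where
  "graph_laplacian n L \<longleftrightarrow> (\<exists>W. weight_matrix n W \<and> L = degree_matrix W - W)"

(* Not the library's orthogonal_mat, which asks only for nonzero pairwise orthogonal columns. *)
definition orthonormal_mat :: "nat \<Rightarrow> real mat \<Rightarrow> bool" where
  "orthonormal_mat n Q \<longleftrightarrow> Q \<in> carrier_mat n n \<and> Q\<^sup>T * Q = 1\<^sub>m n \<and> Q * Q\<^sup>T = 1\<^sub>m n"

definition sorted_eigendecomp :: "nat \<Rightarrow> real mat \<Rightarrow> real mat \<Rightarrow> real mat \<Rightarrow> bool" where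
  "sorted_eigendecomp n L Q \<Lambda> \<longleftrightarrow>
     orthonormal_mat n Q \<and> \<Lambda> \<in> carrier_mat n n \<and> diagonal_mat \<Lambda> \<and>
     sorted (diag_mat \<Lambda>) \<and> L = Q * \<Lambda> * Q\<^sup>T"

(* The k-th smallest eigenvalue, counted from 1, when \<Lambda> comes from sorted_eigendecomp. *)
definition eigval :: "real mat \<Rightarrow> nat \<Rightarrow> real" where
  "eigval \<Lambda> k = \<Lambda> $$ (k - 1, k - 1)"

definition first_cols :: "nat \<Rightarrow> real mat \<Rightarrow> real mat" where
  "first_cols k Q = mat_of_cols (dim_row Q) (take k (cols Q))"

definition cols_in_span :: "real mat \<Rightarrow> real mat \<Rightarrow> bool" where
  "cols_in_span A B \<longleftrightarrow> set (cols A) \<subseteq> mat_span B"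

definition LR :: "real mat \<Rightarrow> real mat \<Rightarrow> real mat set" where
  "LR P Q = {Y \<in> carrier_mat (dim_row P) (dim_row Q).
     set (cols Y) \<subseteq> mat_span P \<and> set (rows Y) \<subseteq> mat_span Q}"

definition col_subsampling :: "nat \<Rightarrow> nat \<Rightarrow> real mat \<Rightarrow> bool" where
  "col_subsampling n \<rho> M \<longleftrightarrow> (\<exists>\<omega>. inj_on \<omega> {..<\<rho>} \<and> \<omega> ` {..<\<rho>} \<subseteq> {..<n} \<and>
     M = mat n \<rho> (\<lambda>(i,j). if i = \<omega> j then 1 else 0))"

definition row_subsampling :: "nat \<Rightarrow> nat \<Rightarrow> real mat \<Rightarrow> bool" where
  "row_subsampling p \<rho> M \<longleftrightarrow> (\<exists>\<omega>. inj_on \<omega> {..<\<rho>} \<and> \<omega> ` {..<\<rho>} \<subseteq> {..<p} \<and>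
     M = mat \<rho> p (\<lambda>(i,j). if j = \<omega> i then 1 else 0))"

definition graph_decoder_objective ::
    "real mat \<Rightarrow> real mat \<Rightarrow> real \<Rightarrow> real mat \<Rightarrow> real mat \<Rightarrow> real" where
  "graph_decoder_objective M B \<gamma> L X =
     (frob_norm (M * X - B))\<^sup>2 + \<gamma> * mat_trace (X\<^sup>T * L * X)"

end

theory Submission
  imports Defs "HOL-Analysis.L2_Norm"
begin

text \<open>Each factor is treated separately. Comparing the objective at the minimiser \<open>U\<close> with its value
  at the low-frequency matrix \<open>X\<close> that was sampled gives
  \<open>\<parallel>M U - B\<parallel>\<^sup>2 + \<gamma> \<lambda>\<^sub>k\<^sub>+\<^sub>1 \<parallel>F\<parallel>\<^sup>2 \<le> \<parallel>E\<parallel>\<^sup>2 + \<gamma> \<lambda>\<^sub>k \<parallel>X\<parallel>\<^sup>2\<close>, where \<open>F\<close> is the high-frequency part of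
  \<open>U\<close>; this bounds both the residual and \<open>F\<close>. The low-frequency error \<open>D\<close> satisfies
  \<open>M D = (M U - B) + E - M F\<close>, so it remains to bound \<open>\<parallel>D\<parallel>\<close> by \<open>\<parallel>M D\<parallel>\<close>. The restricted isometry
  is only assumed for matrices sampled on both sides, but the constant vector has low
  frequency because \<open>\<lambda>\<^sub>k\<^sub>+\<^sub>1 > 0\<close>; applied to the outer product of a column of \<open>D\<close> with it, the
  isometry yields the one-sided estimate.\<close>

section \<open>Frobenius norm, trace and the quadratic form in eigencoordinates\<close>

lemma frob_norm_L2_set:
  "frob_norm A = L2_set (($$) A) ({..<dim_row A} \<times> {..<dim_col A})"
  by (simp add: frob_norm_def L2_set_def sum.cartesian_product case_prod_unfold)

lemma frob_norm_nonneg: "0 \<le> frob_norm A"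
  by (simp add: frob_norm_L2_set)

lemma frob_norm_sq:
  assumes "A \<in> carrier_mat m n"
  shows "(frob_norm A)\<^sup>2 = (\<Sum>i<m. \<Sum>j<n. (A $$ (i,j))\<^sup>2)"
  using assms by (simp add: frob_norm_def sum_nonneg)

lemma frob_norm_add:
  assumes "A \<in> carrier_mat m n" "B \<in> carrier_mat m n"
  shows "frob_norm (A + B) \<le> frob_norm A + frob_norm B"
proof -
  let ?S = "{..<m} \<times> {..<n}"
  have "frob_norm (A + B) = L2_set (\<lambda>x. A $$ x + B $$ x) ?S"
    using assms by (auto simp: frob_norm_L2_set intro!: L2_set_cong)
  also have "\<dots> \<le> L2_set (($$) A) ?S + L2_set (($$) B) ?S"
    by (rule L2_set_triangle_ineq)
  finally show ?thesis
    using assms by (simp add: frob_norm_L2_set)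
qed

lemma frob_norm_uminus: "frob_norm (- A) = frob_norm A"
  by (simp add: frob_norm_def)

lemma frob_norm_diff:
  assumes "A \<in> carrier_mat m n" "B \<in> carrier_mat m n"
  shows "frob_norm (A - B) \<le> frob_norm A + frob_norm B"
proof -
  have "A - B = A + (- B)"
    using assms by auto
  then show ?thesis
    using frob_norm_add[of A m n "- B"] assms by (simp add: frob_norm_uminus)
qed

lemma mat_trace_transpose_mult:
  assumes "A \<in> carrier_mat m n" "B \<in> carrier_mat m n"
  shows "mat_trace (A\<^sup>T * B) = (\<Sum>i<m. \<Sum>j<n. A $$ (i,j) * B $$ (i,j))"
proof -
  have "mat_trace (A\<^sup>T * B) = (\<Sum>j<n. \<Sum>i<m. A $$ (i,j) * B $$ (i,j))"
    using assms by (auto simp: mat_trace_def scalar_prod_def lessThan_atLeast0 intro!: sum.cong)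
  also have "\<dots> = (\<Sum>i<m. \<Sum>j<n. A $$ (i,j) * B $$ (i,j))"
    by (rule sum.swap)
  finally show ?thesis .
qed

text \<open>The squared norm is the trace of the Gram matrix, and
  \<open>Q * Q\<^sup>T = 1\<^sub>m n\<close> cancels inside the Gram matrix of
  \<open>Q\<^sup>T * X\<close>. Norms can thus be computed from the coordinates in the
  eigenbasis.\<close>

lemma frob_norm_orthonormal_transpose:
  assumes "orthonormal_mat n Q" "X \<in> carrier_mat n k"
  shows "(frob_norm (Q\<^sup>T * X))\<^sup>2 = (frob_norm X)\<^sup>2"
proof -
  have Q: "Q \<in> carrier_mat n n" "Q * Q\<^sup>T = 1\<^sub>m n"
    using assms by (auto simp: orthonormal_mat_def)
  have tr: "(frob_norm A)\<^sup>2 = mat_trace (A\<^sup>T * A)" if "A \<in> carrier_mat n k" for A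
    unfolding frob_norm_sq[OF that] mat_trace_transpose_mult[OF that that]
    by (simp add: power2_eq_square)
  have "(Q\<^sup>T * X)\<^sup>T * (Q\<^sup>T * X) = (X\<^sup>T * Q) * (Q\<^sup>T * X)"
    using Q assms by (simp add: transpose_mult[of "Q\<^sup>T" n n X k])
  also have "\<dots> = X\<^sup>T * (Q * (Q\<^sup>T * X))"
    by (rule assoc_mult_mat[of _ k n _ n _ k]) (use Q assms in auto)
  also have "Q * (Q\<^sup>T * X) = (Q * Q\<^sup>T) * X"
    by (rule assoc_mult_mat[symmetric, of _ n n _ n _ k]) (use Q assms in auto)
  also have "\<dots> = X"
    using Q assms by simp
  finally show ?thesis
    using tr[of X] tr[of "Q\<^sup>T * X"] Q assms by simp
qed

lemma diagonal_mult_index: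
  assumes "D \<in> carrier_mat n n" "diagonal_mat D" "C \<in> carrier_mat n k" "i < n" "j < k"
  shows "(D * C) $$ (i,j) = D $$ (i,i) * C $$ (i,j)"
proof -
  have "(D * C) $$ (i,j) = (\<Sum>l<n. D $$ (i,l) * C $$ (l,j))"
    using assms by (simp add: scalar_prod_def lessThan_atLeast0)
  also have "\<dots> = (\<Sum>l<n. if l = i then D $$ (i,i) * C $$ (i,j) else 0)"
    using assms by (intro sum.cong) (auto simp: diagonal_mat_def)
  finally show ?thesis
    using assms by simp
qed

text \<open>Regrouping the factors of \<open>L\<close> turns the matrix under the trace into
  \<open>C\<^sup>T * (\<Lambda> * C)\<close> with \<open>C = Q\<^sup>T * X\<close>; the diagonal
  \<open>\<Lambda>\<close> only rescales the rows of \<open>C\<close>.\<close>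

lemma quadratic_form_eigenbasis:
  assumes "sorted_eigendecomp n L Q \<Lambda>" "X \<in> carrier_mat n k"
  shows "mat_trace (X\<^sup>T * L * X) = (\<Sum>i<n. \<Lambda> $$ (i,i) * (\<Sum>j<k. ((Q\<^sup>T * X) $$ (i,j))\<^sup>2))"
proof -
  have Q: "Q \<in> carrier_mat n n" and D: "\<Lambda> \<in> carrier_mat n n" "diagonal_mat \<Lambda>"
    and L: "L = Q * \<Lambda> * Q\<^sup>T"
    using assms by (auto simp: sorted_eigendecomp_def orthonormal_mat_def)
  let ?C = "Q\<^sup>T * X"
  have C: "?C \<in> carrier_mat n k"
    using Q assms by simp
  have "X\<^sup>T * L * X = X\<^sup>T * (L * X)"
    by (rule assoc_mult_mat[of _ k n _ n _ k]) (use Q D L assms in auto)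
  also have "L * X = (Q * \<Lambda>) * ?C"
    unfolding L by (rule assoc_mult_mat[of _ n n _ n _ k]) (use Q D assms in auto)
  also have "\<dots> = Q * (\<Lambda> * ?C)"
    by (rule assoc_mult_mat[of _ n n _ n _ k]) (use Q D C in auto)
  also have "X\<^sup>T * \<dots> = (X\<^sup>T * Q) * (\<Lambda> * ?C)"
    by (rule assoc_mult_mat[symmetric, of _ k n _ n _ k]) (use Q D C assms in auto)
  also have "X\<^sup>T * Q = ?C\<^sup>T"
    using Q assms by (simp add: transpose_mult[of "Q\<^sup>T" n n X k])
  finally have "mat_trace (X\<^sup>T * L * X) = (\<Sum>i<n. \<Sum>j<k. ?C $$ (i,j) * (\<Lambda> * ?C) $$ (i,j))"
    using mat_trace_transpose_mult[OF C, of "\<Lambda> * ?C"] D C by simp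
  also have "\<dots> = (\<Sum>i<n. \<Sum>j<k. ?C $$ (i,j) * (\<Lambda> $$ (i,i) * ?C $$ (i,j)))"
    by (intro sum.cong refl arg_cong2[where f = "(*)"] diagonal_mult_index[OF D C]) auto
  also have "\<dots> = (\<Sum>i<n. \<Lambda> $$ (i,i) * (\<Sum>j<k. (?C $$ (i,j))\<^sup>2))"
    by (simp only: sum_distrib_left power2_eq_square mult.left_commute)
  finally show ?thesis .
qed

section \<open>Graph Laplacians: symmetry, positive semidefiniteness, constant kernel vector\<close>

lemma graph_laplacian_carrier: "graph_laplacian n L \<Longrightarrow> L \<in> carrier_mat n n"
  by (auto simp: graph_laplacian_def weight_matrix_def degree_matrix_def mat_diag_def)

text \<open>The degree of a vertex is the sum of its weights, so it distributes over the neighbours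
  and leaves differences. In this form constants are visibly in the kernel and loops cancel.\<close>

lemma graph_laplacian_mult_vec:
  assumes W: "weight_matrix n W" and L: "L = degree_matrix W - W"
    and x: "x \<in> carrier_vec n" and i: "i < n"
  shows "(L *\<^sub>v x) $ i = (\<Sum>j<n. W $$ (i,j) * (x $ i - x $ j))"
proof -
  have Wc: "W \<in> carrier_mat n n"
    using W by (simp add: weight_matrix_def)
  have "(L *\<^sub>v x) $ i = (\<Sum>j<n. L $$ (i,j) * x $ j)"
    using L Wc x i by (simp add: scalar_prod_def lessThan_atLeast0 degree_matrix_def mat_diag_def)
  also have "\<dots> = (\<Sum>j<n. (if j = i then (\<Sum>l<n. W $$ (i,l)) * x $ i else 0) - W $$ (i,j) * x $ j)"
    using Wc i by (intro sum.cong) (auto simp: L degree_matrix_def mat_diag_def algebra_simps)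
  also have "\<dots> = (\<Sum>l<n. W $$ (i,l)) * x $ i - (\<Sum>j<n. W $$ (i,j) * x $ j)"
    using i by (simp add: sum_subtractf)
  finally show ?thesis
    by (simp add: right_diff_distrib sum_subtractf sum_distrib_right)
qed

lemma graph_laplacian_psd:
  assumes "graph_laplacian n L" and x: "x \<in> carrier_vec n"
  shows "0 \<le> x \<bullet> (L *\<^sub>v x)"
proof -
  obtain W where W: "weight_matrix n W" and L: "L = degree_matrix W - W"
    using assms by (auto simp: graph_laplacian_def)
  have Wc: "W \<in> carrier_mat n n" and W0: "\<And>i j. i < n \<Longrightarrow> j < n \<Longrightarrow> 0 \<le> W $$ (i,j)"
    using W by (auto simp: weight_matrix_def)
  have sym: "W $$ (i,j) = W $$ (j,i)" if "i < n" "j < n" for i j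
    using W Wc that index_transpose_mat(1)[of i W j] by (simp add: weight_matrix_def)
  have Lc: "L \<in> carrier_mat n n"
    using assms(1) by (rule graph_laplacian_carrier)
  let ?S = "\<Sum>i<n. \<Sum>j<n. x $ i * (W $$ (i,j) * (x $ i - x $ j))"
  have q: "x \<bullet> (L *\<^sub>v x) = ?S"
    using Lc x by (simp add: scalar_prod_def lessThan_atLeast0[symmetric] sum_distrib_left
        graph_laplacian_mult_vec[OF W L x] del: index_mult_mat_vec)
  \<comment> \<open>Exchanging the two summation indices and using the symmetry of \<open>W\<close>
    gives a second expression for the same sum. Adding both produces weighted squares of
    differences.\<close>
  have "?S = (\<Sum>i<n. \<Sum>j<n. x $ j * (W $$ (j,i) * (x $ j - x $ i)))"
    by (rule sum.swap)
  also have "\<dots> = (\<Sum>i<n. \<Sum>j<n. x $ j * (W $$ (i,j) * (x $ j - x $ i)))"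
    by (intro sum.cong refl) (simp add: sym)
  finally have "2 * ?S = (\<Sum>i<n. \<Sum>j<n. x $ i * (W $$ (i,j) * (x $ i - x $ j)))
      + (\<Sum>i<n. \<Sum>j<n. x $ j * (W $$ (i,j) * (x $ j - x $ i)))"
    by simp
  also have "\<dots> = (\<Sum>i<n. \<Sum>j<n. W $$ (i,j) * (x $ i - x $ j)\<^sup>2)"
    by (simp add: sum.distrib[symmetric] power2_eq_square algebra_simps)
  also have "\<dots> \<ge> 0"
    using W0 by (intro sum_nonneg) auto
  finally show ?thesis
    using q by simp
qed

lemma graph_laplacian_symmetric:
  assumes "graph_laplacian n L"
  shows "L\<^sup>T = L"
proof -
  obtain W where W: "W \<in> carrier_mat n n" "W\<^sup>T = W" and L: "L = degree_matrix W - W"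
    using assms by (auto simp: graph_laplacian_def weight_matrix_def)
  have sym: "W $$ (i,j) = W $$ (j,i)" if "i < n" "j < n" for i j
    using W that index_transpose_mat(1)[of i W j] by simp
  show ?thesis
    unfolding L using W(1)
    by (intro eq_matI) (auto simp: degree_matrix_def mat_diag_def sym)
qed

lemma graph_laplacian_ones:
  assumes "graph_laplacian n L"
  shows "L *\<^sub>v vec n (\<lambda>_. 1) = 0\<^sub>v n"
proof -
  obtain W where W: "weight_matrix n W" "L = degree_matrix W - W"
    using assms by (auto simp: graph_laplacian_def)
  show ?thesis
    using graph_laplacian_mult_vec[OF W] graph_laplacian_carrier[OF assms]
    by (intro eq_vecI) (auto simp del: index_mult_mat_vec)
qed

section \<open>Eigenvectors and ordered eigenvalues\<close>

lemma eigenvector_col: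
  assumes "sorted_eigendecomp n L Q \<Lambda>" "i < n"
  shows "L *\<^sub>v col Q i = \<Lambda> $$ (i,i) \<cdot>\<^sub>v col Q i"
proof -
  have Q: "Q \<in> carrier_mat n n" "Q\<^sup>T * Q = 1\<^sub>m n" and D: "\<Lambda> \<in> carrier_mat n n" "diagonal_mat \<Lambda>"
    and L: "L = Q * \<Lambda> * Q\<^sup>T"
    using assms by (auto simp: sorted_eigendecomp_def orthonormal_mat_def)
  have "L * Q = Q * \<Lambda> * (Q\<^sup>T * Q)"
    unfolding L by (rule assoc_mult_mat[of _ n n _ n _ n]) (use Q D in auto)
  then have LQ: "L * Q = Q * \<Lambda>"
    using Q D by simp
  have "L *\<^sub>v col Q i = col (L * Q) i"
    using Q D L assms by (subst col_mult2[of _ n n _ n]) auto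
  also have "\<dots> = Q *\<^sub>v col \<Lambda> i"
    unfolding LQ using Q D assms by (subst col_mult2[of _ n n _ n]) auto
  also have "\<dots> = \<Lambda> $$ (i,i) \<cdot>\<^sub>v col Q i"
  proof (rule eq_vecI)
    fix r assume r: "r < dim_vec (\<Lambda> $$ (i,i) \<cdot>\<^sub>v col Q i)"
    have "(Q *\<^sub>v col \<Lambda> i) $ r = (\<Sum>l<n. Q $$ (r,l) * \<Lambda> $$ (l,i))"
      using Q D r assms by (simp add: scalar_prod_def lessThan_atLeast0)
    also have "\<dots> = (\<Sum>l<n. if l = i then Q $$ (r,i) * \<Lambda> $$ (i,i) else 0)"
      using D assms by (intro sum.cong) (auto simp: diagonal_mat_def)
    finally show "(Q *\<^sub>v col \<Lambda> i) $ r = (\<Lambda> $$ (i,i) \<cdot>\<^sub>v col Q i) $ r"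
      using Q r assms by simp
  qed (use Q in auto)
  finally show ?thesis .
qed

lemma col_norm_orthonormal:
  assumes "orthonormal_mat n Q" "i < n"
  shows "col Q i \<bullet> col Q i = 1"
proof -
  have Q: "Q \<in> carrier_mat n n" "Q\<^sup>T * Q = 1\<^sub>m n"
    using assms by (auto simp: orthonormal_mat_def)
  have "(Q\<^sup>T * Q) $$ (i,i) = col Q i \<bullet> col Q i"
    using Q(1) assms(2) by simp
  then show ?thesis
    using Q assms by simp
qed

text \<open>At a column of \<open>Q\<close>, which is a unit eigenvector, the nonnegative quadratic
  form takes the eigenvalue itself as its value.\<close>

lemma graph_laplacian_eigenvalue_nonneg:
  assumes "graph_laplacian n L" "sorted_eigendecomp n L Q \<Lambda>" "i < n"
  shows "0 \<le> \<Lambda> $$ (i,i)"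
proof -
  have o: "orthonormal_mat n Q" and Q: "Q \<in> carrier_mat n n"
    using assms by (auto simp: sorted_eigendecomp_def orthonormal_mat_def)
  then have "col Q i \<bullet> (L *\<^sub>v col Q i) = \<Lambda> $$ (i,i)"
    using eigenvector_col[OF assms(2,3)] col_norm_orthonormal[OF o assms(3)] by simp
  then show ?thesis
    using graph_laplacian_psd[OF assms(1), of "col Q i"] Q col_dim[of Q i] by simp
qed

lemma eigenvalue_mono:
  assumes "sorted_eigendecomp n L Q \<Lambda>" "i \<le> j" "j < n"
  shows "\<Lambda> $$ (i,i) \<le> \<Lambda> $$ (j,j)"
proof -
  have "sorted (diag_mat \<Lambda>)" "dim_row \<Lambda> = n"
    using assms by (auto simp: sorted_eigendecomp_def)
  then show ?thesis
    using sorted_nth_mono[of "diag_mat \<Lambda>" i j] assms by (simp add: diag_mat_def)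
qed

section \<open>The low-frequency subspace\<close>

lemma first_cols_eq_mat:
  assumes "Q \<in> carrier_mat n n" "k \<le> n"
  shows "first_cols k Q = mat n k (\<lambda>(i,j). Q $$ (i,j))"
  using assms by (intro eq_matI) (auto simp: first_cols_def mat_of_cols_index)

text \<open>By orthonormality \<open>Q\<^sup>T * first_cols kk Q\<close> is an identity block above
  zero rows. Hence a matrix in the low-frequency span has its coefficients as its first
  \<open>kk\<close> rows of eigencoordinates, and zeros below.\<close>

lemma transpose_mult_first_cols:
  assumes o: "orthonormal_mat n Q" and kk: "kk \<le> n" and C: "C \<in> carrier_mat kk k"
    and ij: "i < n" "j < k"
  shows "(Q\<^sup>T * (first_cols kk Q * C)) $$ (i,j) = (if i < kk then C $$ (i,j) else 0)"
proof -
  have Q: "Q \<in> carrier_mat n n" "Q\<^sup>T * Q = 1\<^sub>m n"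
    using o by (auto simp: orthonormal_mat_def)
  note F = first_cols_eq_mat[OF Q(1) kk]
  have G: "Q\<^sup>T * first_cols kk Q = mat n kk (\<lambda>(i,j). if i = j then 1 else 0)"
  proof (rule eq_matI)
    fix a b assume "a < dim_row (mat n kk (\<lambda>(i,j). if i = j then 1 else (0::real)))"
      "b < dim_col (mat n kk (\<lambda>(i,j). if i = j then 1 else (0::real)))"
    then have ab: "a < n" "b < kk" by auto
    have "(Q\<^sup>T * first_cols kk Q) $$ (a,b) = (Q\<^sup>T * Q) $$ (a,b)"
      using Q(1) ab kk by (simp add: F scalar_prod_def)
    then show "(Q\<^sup>T * first_cols kk Q) $$ (a,b) = mat n kk (\<lambda>(i,j). if i = j then 1 else 0) $$ (a,b)"
      using ab kk by (simp add: Q(2))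
  qed (use Q F in auto)
  have "Q\<^sup>T * (first_cols kk Q * C) = (Q\<^sup>T * first_cols kk Q) * C"
    by (rule assoc_mult_mat[symmetric, of _ n n _ kk _ k]) (use Q F C in auto)
  then have "(Q\<^sup>T * (first_cols kk Q * C)) $$ (i,j)
      = (\<Sum>l<kk. (if i = l then 1 else 0) * C $$ (l,j))"
    using C ij by (simp add: G scalar_prod_def lessThan_atLeast0)
  also have "\<dots> = (\<Sum>l<kk. if i = l then C $$ (i,j) else 0)"
    by (intro sum.cong) auto
  finally show ?thesis
    by simp
qed

lemma mem_mat_span_iff:
  assumes "A \<in> carrier_mat n m"
  shows "x \<in> mat_span A \<longleftrightarrow> (\<exists>c \<in> carrier_vec m. A *\<^sub>v c = x)"
  using vec_space.col_space_eq[of A "dim_row A" m] assms mult_mat_vec_carrier[OF assms] by auto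

text \<open>A coefficient vector is chosen for every column of \<open>X\<close>, and these vectors
  become the columns of \<open>C\<close>.\<close>

lemma cols_in_span_imp_mult:
  assumes A: "A \<in> carrier_mat n m" and X: "X \<in> carrier_mat n k" and s: "cols_in_span X A"
  obtains C where "C \<in> carrier_mat m k" "X = A * C"
proof -
  have "\<forall>j<k. \<exists>c. c \<in> carrier_vec m \<and> A *\<^sub>v c = col X j"
  proof (intro allI impI)
    fix j assume "j < k"
    then have "col X j \<in> mat_span A"
      using s X by (auto simp: cols_in_span_def cols_def)
    then show "\<exists>c. c \<in> carrier_vec m \<and> A *\<^sub>v c = col X j"
      using mem_mat_span_iff[OF A] by blast
  qed
  then obtain c where c: "\<And>j. j < k \<Longrightarrow> c j \<in> carrier_vec m" "\<And>j. j < k \<Longrightarrow> A *\<^sub>v c j = col X j"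
    by metis
  define C where "C = mat m k (\<lambda>(i,j). c j $ i)"
  have colC: "col C j = c j" if "j < k" for j
    using c(1)[OF that] that by (intro eq_vecI) (auto simp: C_def)
  have "X = A * C"
  proof (rule mat_col_eqI)
    fix j assume "j < dim_col (A * C)"
    then have j: "j < k" by (simp add: C_def)
    then show "col X j = col (A * C) j"
      using c(2)[OF j] colC[OF j] A by (subst col_mult2[of _ n m _ k]) (auto simp: C_def)
  qed (use A X in \<open>auto simp: C_def\<close>)
  then show thesis
    using that[of C] by (simp add: C_def)
qed

lemma cols_in_span_mult:
  assumes A: "A \<in> carrier_mat n m" and C: "C \<in> carrier_mat m k"
  shows "cols_in_span (A * C) A"
proof -
  have "col (A * C) j \<in> mat_span A" if "j < k" for j
  proof -
    have "col C j \<in> carrier_vec m"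
      using C by auto
    then show ?thesis
      unfolding mem_mat_span_iff[OF A] col_mult2[OF A C that] by blast
  qed
  then show ?thesis
    using C by (auto simp: cols_in_span_def cols_def simp del: col_mult2)
qed

text \<open>\<open>L\<close> is symmetric and kills the constant vector, so the latter is orthogonal
  to every eigenvector with positive eigenvalue. Its expansion in the basis \<open>Q\<close>
  therefore stops before index \<open>kk\<close>.\<close>

lemma ones_in_low_eigenspace:
  assumes lap: "graph_laplacian n L" and eig: "sorted_eigendecomp n L Q \<Lambda>"
    and kk: "kk < n" and gap: "0 < eigval \<Lambda> (kk + 1)"
  shows "vec n (\<lambda>_. 1) \<in> mat_span (first_cols kk Q)"
proof -
  let ?e = "vec n (\<lambda>_. 1) :: real vec"
  have Q: "Q \<in> carrier_mat n n" "Q * Q\<^sup>T = 1\<^sub>m n"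
    using eig by (auto simp: sorted_eigendecomp_def orthonormal_mat_def)
  note F = first_cols_eq_mat[OF Q(1) less_imp_le[OF kk]]
  have W: "L \<in> carrier_mat n n" by (rule graph_laplacian_carrier[OF lap])
  have LT: "L\<^sup>T = L"
    by (rule graph_laplacian_symmetric[OF lap])
  have zero: "col Q i \<bullet> ?e = 0" if i: "kk \<le> i" "i < n" for i
  proof -
    \<comment> \<open>\<open>eigval\<close> counts from 1 and matrix indices from 0: the gap
      hypothesis concerns the entry \<open>(kk,kk)\<close>, and sortedness extends positivity to all
      later entries.\<close>
    have pos: "0 < \<Lambda> $$ (i,i)"
      using gap eigenvalue_mono[OF eig, of kk i] i by (simp add: eigval_def)
    have ci: "col Q i \<in> carrier_vec n"
      using Q by auto
    have "\<Lambda> $$ (i,i) * (col Q i \<bullet> ?e) = (L *\<^sub>v col Q i) \<bullet> ?e"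
      using eigenvector_col[OF eig i(2)] ci by simp
    also have "\<dots> = col Q i \<bullet> (L *\<^sub>v ?e)"
      using transpose_vec_mult_scalar[OF W, of "col Q i" ?e] transpose_vec_mult_scalar[OF W, of ?e "col Q i"] ci LT
      by (simp add: comm_scalar_prod[of _ n])
    also have "\<dots> = 0"
      using graph_laplacian_ones[OF lap] ci by simp
    finally show ?thesis
      using pos by simp
  qed
  have expand: "v $ r = (\<Sum>l<n. Q $$ (r,l) * (col Q l \<bullet> v))"
    if v: "v \<in> carrier_vec n" and r: "r < n" for v r
  proof -
    have "v = (Q * Q\<^sup>T) *\<^sub>v v"
      unfolding Q(2) using v by simp
    also have "\<dots> = Q *\<^sub>v (Q\<^sup>T *\<^sub>v v)"
      by (rule assoc_mult_mat_vec) (use Q v in auto)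
    finally have "v $ r = (Q *\<^sub>v (Q\<^sup>T *\<^sub>v v)) $ r"
      by simp
    also have "\<dots> = (\<Sum>l<n. Q $$ (r,l) * (col Q l \<bullet> v))"
      using Q(1) r v by (simp add: scalar_prod_def lessThan_atLeast0)
    finally show ?thesis .
  qed
  define c where "c = vec kk (\<lambda>i. col Q i \<bullet> ?e)"
  have "first_cols kk Q *\<^sub>v c = ?e"
  proof (rule eq_vecI)
    fix r assume r: "r < dim_vec ?e"
    have "?e $ r = (\<Sum>l<n. Q $$ (r,l) * (col Q l \<bullet> ?e))"
      using expand[of ?e r] r by simp
    also have "\<dots> = (\<Sum>l<kk. Q $$ (r,l) * (col Q l \<bullet> ?e))"
      using kk zero by (intro sum.mono_neutral_right) auto
    also have "\<dots> = (first_cols kk Q *\<^sub>v c) $ r"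
      using Q r by (simp add: F c_def scalar_prod_def lessThan_atLeast0)
    finally show "(first_cols kk Q *\<^sub>v c) $ r = ?e $ r" by simp
  qed (simp add: F)
  then show ?thesis
    using mem_mat_span_iff[of "first_cols kk Q" n kk] F c_def by auto
qed

section \<open>Row subsampling and the error bounds for one factor\<close>

lemma row_subsampling_mult_index:
  assumes "M = mat \<rho> n (\<lambda>(i,j). if j = \<omega> i then 1 else (0::real))" "\<omega> ` {..<\<rho>} \<subseteq> {..<n}"
    "X \<in> carrier_mat n k" "a < \<rho>" "j < k"
  shows "(M * X) $$ (a,j) = X $$ (\<omega> a,j)"
proof -
  have "(M * X) $$ (a,j) = (\<Sum>i<n. (if i = \<omega> a then 1 else 0) * X $$ (i,j))"
    using assms by (simp add: scalar_prod_def lessThan_atLeast0)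
  also have "\<dots> = (\<Sum>i<n. if i = \<omega> a then X $$ (\<omega> a,j) else 0)"
    by (intro sum.cong) auto
  finally show ?thesis
    using assms by auto
qed

lemma row_subsampling_carrier: "row_subsampling n \<rho> M \<Longrightarrow> M \<in> carrier_mat \<rho> n"
  by (auto simp: row_subsampling_def)

text \<open>The sampled indices are distinct, so every row of \<open>X\<close> is counted at most
  once.\<close>

lemma frob_norm_row_subsampling_le:
  assumes M: "row_subsampling n \<rho> M" and X: "X \<in> carrier_mat n k"
  shows "frob_norm (M * X) \<le> frob_norm X"
proof -
  obtain \<omega> where inj: "inj_on \<omega> {..<\<rho>}" and ran: "\<omega> ` {..<\<rho>} \<subseteq> {..<n}"
    and Meq: "M = mat \<rho> n (\<lambda>(i,j). if j = \<omega> i then 1 else 0)"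
    using M by (auto simp: row_subsampling_def)
  have MX: "M * X \<in> carrier_mat \<rho> k"
    by (rule mult_carrier_mat[OF _ X]) (simp add: Meq)
  have "(frob_norm (M * X))\<^sup>2 = (\<Sum>a<\<rho>. \<Sum>j<k. (X $$ (\<omega> a,j))\<^sup>2)"
    unfolding frob_norm_sq[OF MX]
    by (intro sum.cong refl) (simp add: row_subsampling_mult_index[OF Meq ran X] del: index_mult_mat)
  also have "\<dots> = (\<Sum>i\<in>\<omega> ` {..<\<rho>}. \<Sum>j<k. (X $$ (i,j))\<^sup>2)"
    using inj by (simp add: sum.reindex)
  also have "\<dots> \<le> (frob_norm X)\<^sup>2"
    unfolding frob_norm_sq[OF X] using ran by (intro sum_mono2) (auto intro: sum_nonneg)
  finally show ?thesis
    using frob_norm_nonneg power2_le_imp_le by blast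
qed

text \<open>The isometry enters only through the one-sided bound \<open>low\<close>, so the same
  lemma serves \<open>U\<close> sampled by \<open>Mr\<close> and \<open>V\<close> sampled by the
  transpose of \<open>Mc\<close>.\<close>

lemma decoder_error_bounds:
  assumes lap: "graph_laplacian n L" and eig: "sorted_eigendecomp n L Q \<Lambda>"
    and kk: "1 \<le> kk" "kk < n" and A: "A = first_cols kk Q"
    and \<delta>: "\<delta> < 1" and M: "row_subsampling n \<rho> M"
    and low: "\<And>X. X \<in> carrier_mat n k \<Longrightarrow> cols_in_span X A \<Longrightarrow>
        (1 - \<delta>) * (frob_norm X)\<^sup>2 \<le> real n / real \<rho> * (frob_norm (M * X))\<^sup>2"
    and \<gamma>: "0 < \<gamma>" and gap: "0 < eigval \<Lambda> (kk + 1)"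
    and X: "X \<in> carrier_mat n k" "cols_in_span X A" and E: "E \<in> carrier_mat \<rho> k"
    and B: "B = M * X + E"
    and opt: "is_arg_min (graph_decoder_objective M B \<gamma> L) (\<lambda>U. U \<in> carrier_mat n k) Z"
    and Zbar: "Zbar = A * A\<^sup>T * Z" and F: "F = Z - Zbar"
  shows
    "frob_norm (Zbar - X) \<le> sqrt (2 * real n / (real \<rho> * (1 - \<delta>))) *
          ((2 + 1 / sqrt (\<gamma> * eigval \<Lambda> (kk + 1))) * frob_norm E
           + (sqrt (eigval \<Lambda> kk / eigval \<Lambda> (kk + 1)) + sqrt (\<gamma> * eigval \<Lambda> kk)) * frob_norm X)" (is ?g1)
    "frob_norm F \<le> sqrt (2 / (\<gamma> * eigval \<Lambda> (kk + 1))) * frob_norm E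
          + sqrt (2 * (eigval \<Lambda> kk / eigval \<Lambda> (kk + 1))) * frob_norm X" (is ?g2)
proof -
  define \<mu> where "\<mu> = eigval \<Lambda> (kk + 1)"
  define l where "l = eigval \<Lambda> kk"
  have \<mu>: "0 < \<mu>" using gap by (simp add: \<mu>_def)
  have nonneg: "\<And>i. i < n \<Longrightarrow> 0 \<le> \<Lambda> $$ (i,i)"
    by (rule graph_laplacian_eigenvalue_nonneg[OF lap eig])
  have l: "0 \<le> l" using nonneg[of "kk - 1"] kk by (simp add: l_def eigval_def)
  have o: "orthonormal_mat n Q" and Q: "Q \<in> carrier_mat n n"
    using eig by (auto simp: sorted_eigendecomp_def orthonormal_mat_def)
  note Aeq = first_cols_eq_mat[OF Q less_imp_le[OF kk(2)], folded A]
  have Ac: "A \<in> carrier_mat n kk" by (simp add: Aeq)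
  have Mc: "M \<in> carrier_mat \<rho> n" by (rule row_subsampling_carrier[OF M])
  have Z: "Z \<in> carrier_mat n k"
    using opt by (simp add: is_arg_min_def)
  have Zb: "Zbar = A * (A\<^sup>T * Z)"
    unfolding Zbar by (rule assoc_mult_mat[of _ n kk _ n _ k]) (use Ac Z in auto)
  have Zbc: "Zbar \<in> carrier_mat n k"
    unfolding Zbar using Ac Z by simp
  have Fc: "F \<in> carrier_mat n k"
    unfolding F using Zbc by (rule minus_carrier_mat)
  obtain C where C: "C \<in> carrier_mat kk k" and XC: "X = A * C"
    using cols_in_span_imp_mult[OF Ac X] .
  \<comment> \<open>In eigencoordinates the projection \<open>Zbar\<close> keeps the first
    \<open>kk\<close> rows of \<open>Q\<^sup>T * Z\<close>, and \<open>F\<close> keeps the others;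
    \<open>AZ\<close>, \<open>hZb\<close> and \<open>hF\<close> record this.\<close>
  have AZ: "(A\<^sup>T * Z) $$ (i,j) = (Q\<^sup>T * Z) $$ (i,j)" if "i < kk" "j < k" for i j
    using that kk Q Z by (simp add: Aeq scalar_prod_def)
  have hX: "(Q\<^sup>T * X) $$ (i,j) = 0" if "kk \<le> i" "i < n" "j < k" for i j
    using transpose_mult_first_cols[OF o less_imp_le[OF kk(2)] C that(2,3)] that
    by (simp add: XC A del: index_mult_mat)
  have hZb: "(Q\<^sup>T * Zbar) $$ (i,j) = (if i < kk then (Q\<^sup>T * Z) $$ (i,j) else 0)"
    if "i < n" "j < k" for i j
    using transpose_mult_first_cols[OF o less_imp_le[OF kk(2)] _ that, of "A\<^sup>T * Z"] that AZ Ac Z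
    by (simp add: Zb A[symmetric] del: index_mult_mat)
  have hF: "(Q\<^sup>T * F) $$ (i,j) = (if i < kk then 0 else (Q\<^sup>T * Z) $$ (i,j))"
    if "i < n" "j < k" for i j
  proof -
    have "Q\<^sup>T * F = Q\<^sup>T * Z - Q\<^sup>T * Zbar"
      unfolding F by (rule mult_minus_distrib_mat[of _ n n _ k]) (use Q Z Zbc in auto)
    then have "(Q\<^sup>T * F) $$ (i,j) = (Q\<^sup>T * Z) $$ (i,j) - (Q\<^sup>T * Zbar) $$ (i,j)"
      using that Q Zbc by simp
    then show ?thesis
      using hZb[OF that] by simp
  qed
  have norm_spec: "(frob_norm Y)\<^sup>2 = (\<Sum>i<n. \<Sum>j<k. ((Q\<^sup>T * Y) $$ (i,j))\<^sup>2)"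
    if "Y \<in> carrier_mat n k" for Y
    using frob_norm_orthonormal_transpose[OF o that] frob_norm_sq[of "Q\<^sup>T * Y" n k] that Q by simp

  \<comment> \<open>Only the first \<open>kk\<close> rows of the coordinates of \<open>X\<close> can
    be nonzero, and their eigenvalues are at most \<open>l\<close>.\<close>
  have trX: "mat_trace (X\<^sup>T * L * X) \<le> l * (frob_norm X)\<^sup>2"
    unfolding quadratic_form_eigenbasis[OF eig X(1)] norm_spec[OF X(1)]
  proof (subst sum_distrib_left[of l], rule sum_mono)
    fix i assume i: "i \<in> {..<n}"
    show "\<Lambda> $$ (i,i) * (\<Sum>j<k. ((Q\<^sup>T * X) $$ (i,j))\<^sup>2) \<le> l * (\<Sum>j<k. ((Q\<^sup>T * X) $$ (i,j))\<^sup>2)"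
    proof (cases "i < kk")
      case True
      then show ?thesis
        using eigenvalue_mono[OF eig, of i "kk - 1"] kk
        by (intro mult_right_mono sum_nonneg) (auto simp: l_def eigval_def)
    next
      case False
      then show ?thesis
        using hX i by (simp del: index_mult_mat)
    qed
  qed
  \<comment> \<open>The low rows of \<open>Z\<close> contribute nonnegatively and are dropped; the
    remaining rows are those of \<open>F\<close>, with eigenvalues at least
    \<open>\<mu>\<close>.\<close>
  have trZ: "\<mu> * (frob_norm F)\<^sup>2 \<le> mat_trace (Z\<^sup>T * L * Z)"
    unfolding quadratic_form_eigenbasis[OF eig Z] norm_spec[OF Fc]
  proof (subst sum_distrib_left[of \<mu>], rule sum_mono)
    fix i assume i: "i \<in> {..<n}"
    show "\<mu> * (\<Sum>j<k. ((Q\<^sup>T * F) $$ (i,j))\<^sup>2) \<le> \<Lambda> $$ (i,i) * (\<Sum>j<k. ((Q\<^sup>T * Z) $$ (i,j))\<^sup>2)"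
    proof (cases "i < kk")
      case True
      then show ?thesis
        using hF i nonneg by (simp del: index_mult_mat add: sum_nonneg)
    next
      case False
      then have "(\<Sum>j<k. ((Q\<^sup>T * F) $$ (i,j))\<^sup>2) = (\<Sum>j<k. ((Q\<^sup>T * Z) $$ (i,j))\<^sup>2)"
        using hF i by (simp del: index_mult_mat)
      then show ?thesis
        using False i eigenvalue_mono[OF eig, of kk i]
        by (simp del: index_mult_mat) (intro mult_right_mono sum_nonneg, auto simp: \<mu>_def eigval_def)
    qed
  qed

  define R where "R = M * Z - B"
  have MX: "M * X \<in> carrier_mat \<rho> k" and MZ: "M * Z \<in> carrier_mat \<rho> k"
    and MF: "M * F \<in> carrier_mat \<rho> k"
    using Mc X Z Fc by auto
  have Bc: "B \<in> carrier_mat \<rho> k"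
    unfolding B using MX E by simp
  have Rc: "R \<in> carrier_mat \<rho> k"
    unfolding R_def using Bc by (rule minus_carrier_mat)
  \<comment> \<open>The competitor \<open>X\<close> fits the samples up to the noise, which makes
    its objective value explicit.\<close>
  have "M * X - B = - E"
    unfolding B using MX E by (intro eq_matI) (auto simp del: index_mult_mat(1))
  then have nE: "frob_norm (M * X - B) = frob_norm E"
    by (simp add: frob_norm_uminus)
  have "graph_decoder_objective M B \<gamma> L Z \<le> graph_decoder_objective M B \<gamma> L X"
    using opt X(1) unfolding is_arg_min_def by force
  then have "(frob_norm R)\<^sup>2 + \<gamma> * mat_trace (Z\<^sup>T * L * Z) \<le> (frob_norm E)\<^sup>2 + \<gamma> * mat_trace (X\<^sup>T * L * X)"
    by (simp add: graph_decoder_objective_def nE R_def)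
  moreover have "\<gamma> * (\<mu> * (frob_norm F)\<^sup>2) \<le> \<gamma> * mat_trace (Z\<^sup>T * L * Z)"
    using trZ \<gamma> by simp
  moreover have "\<gamma> * mat_trace (X\<^sup>T * L * X) \<le> \<gamma> * (l * (frob_norm X)\<^sup>2)"
    using trX \<gamma> by simp
  ultimately have key: "(frob_norm R)\<^sup>2 + \<gamma> * \<mu> * (frob_norm F)\<^sup>2 \<le> (frob_norm E)\<^sup>2 + \<gamma> * l * (frob_norm X)\<^sup>2"
    by (simp add: mult.assoc)
  note nn = frob_norm_nonneg

  \<comment> \<open>Passes from bounds on squares to linear bounds: the cross term
    \<open>2 * b * c\<close> is nonnegative. It is applied to each summand on the left of
    \<open>key\<close> in turn.\<close>
  have sq: "a \<le> b + c" if "a\<^sup>2 \<le> b\<^sup>2 + c\<^sup>2" "0 \<le> b" "0 \<le> c" for a b c :: real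
  proof (rule power2_le_imp_le)
    show "a\<^sup>2 \<le> (b + c)\<^sup>2"
      using that mult_nonneg_nonneg[of b c] unfolding power2_sum by linarith
  qed (use that in simp)
  have r: "frob_norm R \<le> frob_norm E + sqrt (\<gamma> * l) * frob_norm X"
  proof (rule sq)
    have "0 \<le> \<gamma> * \<mu> * (frob_norm F)\<^sup>2"
      using \<gamma> \<mu> by simp
    then show "(frob_norm R)\<^sup>2 \<le> (frob_norm E)\<^sup>2 + (sqrt (\<gamma> * l) * frob_norm X)\<^sup>2"
      using key \<gamma> l by (simp add: power_mult_distrib)
  qed (use nn \<gamma> l in auto)
  have f: "frob_norm F \<le> 1 / sqrt (\<gamma> * \<mu>) * frob_norm E + sqrt (l / \<mu>) * frob_norm X"
  proof (rule sq)
    have "\<gamma> * \<mu> * (frob_norm F)\<^sup>2 \<le> (frob_norm E)\<^sup>2 + \<gamma> * l * (frob_norm X)\<^sup>2"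
      using key zero_le_power2[of "frob_norm R"] by linarith
    then have "(frob_norm F)\<^sup>2 \<le> ((frob_norm E)\<^sup>2 + \<gamma> * l * (frob_norm X)\<^sup>2) / (\<gamma> * \<mu>)"
      using \<gamma> \<mu> by (simp add: pos_le_divide_eq mult.commute)
    also have "\<dots> = (1 / sqrt (\<gamma> * \<mu>) * frob_norm E)\<^sup>2 + (sqrt (l / \<mu>) * frob_norm X)\<^sup>2"
      using \<gamma> \<mu> l by (simp add: power_mult_distrib power_divide add_divide_distrib)
    finally show "(frob_norm F)\<^sup>2 \<le> \<dots>" .
  qed (use nn \<gamma> \<mu> l in auto)
  \<comment> \<open>The constants in \<open>f\<close> are smaller than the claimed ones by a factor
    \<open>sqrt 2\<close>.\<close>
  have mono: "1 / sqrt (\<gamma> * \<mu>) \<le> sqrt (2 / (\<gamma> * \<mu>))" "sqrt (l / \<mu>) \<le> sqrt (2 * (l / \<mu>))"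
    using \<gamma> \<mu> l by (auto simp: real_sqrt_divide divide_right_mono)
  show ?g2
    unfolding \<mu>_def[symmetric] l_def[symmetric]
    using f mult_right_mono[OF mono(1) nn, of E] mult_right_mono[OF mono(2) nn, of X] by linarith

  define D where "D = Zbar - X"
  have Dc: "D \<in> carrier_mat n k"
    unfolding D_def using X(1) by (rule minus_carrier_mat)
  \<comment> \<open>\<open>Zbar\<close> is \<open>Z - F\<close>, and \<open>M * X\<close> is
    \<open>B - E\<close>.\<close>
  have MD: "M * D = R + E - M * F"
  proof -
    have "M * F = M * Z - M * Zbar"
      unfolding F by (rule mult_minus_distrib_mat[of _ \<rho> n _ k]) (use Mc Z Zbc in auto)
    moreover have "M * D = M * Zbar - M * X"
      unfolding D_def by (rule mult_minus_distrib_mat[of _ \<rho> n _ k]) (use Mc X Zbc in auto)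
    ultimately show ?thesis
      unfolding R_def B using MX MZ E Mc Zbc by (intro eq_matI) (auto simp del: index_mult_mat(1))
  qed
  have "frob_norm (M * D) \<le> frob_norm R + frob_norm E + frob_norm (M * F)"
    unfolding MD using frob_norm_diff[of "R + E" \<rho> k "M * F"] frob_norm_add[OF Rc E] Rc E MF by simp
  \<comment> \<open>The 2 counts the noise once through \<open>r\<close> and once directly; the
    other noise term and the quotient of eigenvalues come from \<open>f\<close>.\<close>
  then have m: "frob_norm (M * D) \<le> (2 + 1 / sqrt (\<gamma> * \<mu>)) * frob_norm E
      + (sqrt (l / \<mu>) + sqrt (\<gamma> * l)) * frob_norm X" (is "_ \<le> ?T")
    using r f frob_norm_row_subsampling_le[OF M Fc] by (simp add: distrib_right)
  have "cols_in_span D A"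
  proof -
    have "D = A * (A\<^sup>T * Z - C)"
      unfolding D_def Zb XC
      by (rule mult_minus_distrib_mat[symmetric, of _ n kk _ k]) (use Ac Z C in auto)
    moreover have "A\<^sup>T * Z - C \<in> carrier_mat kk k"
      using C by (rule minus_carrier_mat)
    ultimately show ?thesis
      using cols_in_span_mult[OF Ac] by simp
  qed
  \<comment> \<open>For an empty sample the quotient by \<open>real \<rho>\<close> is 0, so this
    forces \<open>frob_norm D = 0\<close>, in accordance with the constant 0 in the claim.\<close>
  then have "(1 - \<delta>) * (frob_norm D)\<^sup>2 \<le> real n / real \<rho> * (frob_norm (M * D))\<^sup>2"
    by (rule low[OF Dc])
  then have "(frob_norm D)\<^sup>2 \<le> real n / real \<rho> * (frob_norm (M * D))\<^sup>2 / (1 - \<delta>)"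
    using \<delta> by (subst pos_le_divide_eq) (simp_all only: mult.commute diff_gt_0_iff_gt)
  also have "\<dots> = (real n / (real \<rho> * (1 - \<delta>))) * (frob_norm (M * D))\<^sup>2"
    by simp
  \<comment> \<open>The factor 2 of the claimed constant is introduced here as slack.\<close>
  also have "\<dots> \<le> (2 * real n / (real \<rho> * (1 - \<delta>))) * (frob_norm (M * D))\<^sup>2"
    using \<delta> by (intro mult_right_mono divide_right_mono) auto
  finally have "frob_norm D \<le> sqrt (2 * real n / (real \<rho> * (1 - \<delta>)) * (frob_norm (M * D))\<^sup>2)"
    by (rule real_le_rsqrt)
  also have "\<dots> = sqrt (2 * real n / (real \<rho> * (1 - \<delta>))) * frob_norm (M * D)"
    using nn by (simp only: real_sqrt_mult real_sqrt_abs abs_of_nonneg)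
  also have "\<dots> \<le> sqrt (2 * real n / (real \<rho> * (1 - \<delta>))) * ?T"
    using m \<delta> by (intro mult_left_mono) auto
  finally show ?g1
    unfolding D_def \<mu>_def l_def .
qed

section \<open>From the two-sided isometry to a one-sided bound\<close>

lemma frob_norm_outer_product:
  "(frob_norm (mat m n (\<lambda>(i,j). f i * g j)))\<^sup>2 = (\<Sum>i<m. (f i)\<^sup>2) * (\<Sum>j<n. (g j)\<^sup>2)"
  by (subst frob_norm_sq[of _ m n]) (auto simp: power_mult_distrib sum_product)

lemma frob_norm_cols:
  assumes "X \<in> carrier_mat n k"
  shows "(frob_norm X)\<^sup>2 = (\<Sum>j<k. \<Sum>i<n. (X $$ (i,j))\<^sup>2)"
  unfolding frob_norm_sq[OF assms] by (rule sum.swap)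

lemma col_subsampling_mult_index:
  assumes "M = mat n \<rho> (\<lambda>(i,j). if i = \<omega> j then 1 else (0::real))" "\<omega> ` {..<\<rho>} \<subseteq> {..<n}"
    "X \<in> carrier_mat m n" "i < m" "b < \<rho>"
  shows "(X * M) $$ (i,b) = X $$ (i,\<omega> b)"
proof -
  have "(X * M) $$ (i,b) = (\<Sum>l<n. X $$ (i,l) * (if l = \<omega> b then 1 else 0))"
    using assms by (simp add: scalar_prod_def lessThan_atLeast0)
  also have "\<dots> = (\<Sum>l<n. if l = \<omega> b then X $$ (i,\<omega> b) else 0)"
    by (intro sum.cong) auto
  finally show ?thesis
    using assms by auto
qed

text \<open>Turns the problem for \<open>V\<close> into one with row sampling.\<close>

lemma row_subsampling_transpose:
  assumes "col_subsampling n \<rho> M"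
  shows "row_subsampling n \<rho> M\<^sup>T"
proof -
  obtain \<omega> where w: "inj_on \<omega> {..<\<rho>}" "\<omega> ` {..<\<rho>} \<subseteq> {..<n}"
    and M: "M = mat n \<rho> (\<lambda>(i,j). if i = \<omega> j then 1 else 0)"
    using assms by (auto simp: col_subsampling_def)
  have "M\<^sup>T = mat \<rho> n (\<lambda>(i,j). if j = \<omega> i then 1 else 0)"
    unfolding M by (intro eq_matI) auto
  then show ?thesis
    using w by (auto simp: row_subsampling_def)
qed

text \<open>Every column is a multiple of \<open>x\<close> and every row a multiple of
  \<open>y\<close>, so scaling the coefficient vectors of \<open>x\<close> and \<open>y\<close>
  suffices.\<close>

lemma outer_product_in_LR:
  assumes "A \<in> carrier_mat p m" "B \<in> carrier_mat n l"
    and x: "x \<in> mat_span A" and y: "y \<in> mat_span B"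
  shows "mat p n (\<lambda>(i,j). x $ i * y $ j) \<in> LR A B"
proof -
  let ?Y = "mat p n (\<lambda>(i,j). x $ i * y $ j)"
  obtain c d where c: "c \<in> carrier_vec m" "A *\<^sub>v c = x" and d: "d \<in> carrier_vec l" "B *\<^sub>v d = y"
    using x y assms mem_mat_span_iff by metis
  have "col ?Y j \<in> mat_span A" if "j < n" for j
  proof -
    have "A *\<^sub>v (y $ j \<cdot>\<^sub>v c) = col ?Y j"
      using c that assms(1) by (intro eq_vecI) auto
    then show ?thesis
      using mem_mat_span_iff[OF assms(1)] c by (metis smult_carrier_vec)
  qed
  moreover have "row ?Y i \<in> mat_span B" if "i < p" for i
  proof -
    have "B *\<^sub>v (x $ i \<cdot>\<^sub>v d) = row ?Y i"
      using d that assms(2) by (intro eq_vecI) auto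
    then show ?thesis
      using mem_mat_span_iff[OF assms(2)] d by (metis smult_carrier_vec)
  qed
  ultimately show ?thesis
    using assms(1,2) by (auto simp: LR_def cols_def rows_def)
qed

text \<open>Sampling an outer product on both sides samples its two vectors separately, and the
  Frobenius norm of an outer product factorises.\<close>

lemma rip_outer_product:
  assumes "A \<in> carrier_mat p m" "B \<in> carrier_mat n l"
    and x: "x \<in> mat_span A" and y: "y \<in> mat_span B"
    and Mr: "Mr = mat \<rho>r p (\<lambda>(i,j). if j = \<omega>r i then 1 else 0)" "\<omega>r ` {..<\<rho>r} \<subseteq> {..<p}"
    and Mc: "Mc = mat n \<rho>c (\<lambda>(i,j). if i = \<omega>c j then 1 else 0)" "\<omega>c ` {..<\<rho>c} \<subseteq> {..<n}"
    and rip: "\<And>Y. Y \<in> LR A B \<Longrightarrow> a * (frob_norm Y)\<^sup>2 \<le> s * (frob_norm (Mr * Y * Mc))\<^sup>2"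
  shows "a * ((\<Sum>i<p. (x $ i)\<^sup>2) * (\<Sum>j<n. (y $ j)\<^sup>2))
    \<le> s * ((\<Sum>i<\<rho>r. (x $ \<omega>r i)\<^sup>2) * (\<Sum>j<\<rho>c. (y $ \<omega>c j)\<^sup>2))"
proof -
  let ?Y = "mat p n (\<lambda>(i,j). x $ i * y $ j)"
  have Y: "?Y \<in> carrier_mat p n" by simp
  have MY: "Mr * ?Y \<in> carrier_mat \<rho>r n"
    by (rule mult_carrier_mat[OF _ Y]) (simp add: Mr(1))
  have "Mr * ?Y * Mc = mat \<rho>r \<rho>c (\<lambda>(i,j). x $ \<omega>r i * y $ \<omega>c j)"
  proof (rule eq_matI)
    fix i j assume "i < dim_row (mat \<rho>r \<rho>c (\<lambda>(i,j). x $ \<omega>r i * y $ \<omega>c j))"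
      "j < dim_col (mat \<rho>r \<rho>c (\<lambda>(i,j). x $ \<omega>r i * y $ \<omega>c j))"
    then have ij: "i < \<rho>r" "j < \<rho>c" by auto
    then have w: "\<omega>r i < p" "\<omega>c j < n"
      using Mr(2) Mc(2) by auto
    show "(Mr * ?Y * Mc) $$ (i,j) = mat \<rho>r \<rho>c (\<lambda>(i,j). x $ \<omega>r i * y $ \<omega>c j) $$ (i,j)"
      unfolding col_subsampling_mult_index[OF Mc MY ij]
        row_subsampling_mult_index[OF Mr Y ij(1) w(2)]
      using ij w by simp
  qed (use Mr Mc in auto)
  then show ?thesis
    using rip[OF outer_product_in_LR[OF assms(1-4)]] by (simp add: frob_norm_outer_product)
qed

text \<open>Arranged by columns, because the isometry is tested on one column at a time.\<close>

lemma frob_norm_subsampled_cols: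
  assumes "M = mat \<rho> n (\<lambda>(i,j). if j = \<omega> i then 1 else (0::real))" "\<omega> ` {..<\<rho>} \<subseteq> {..<n}"
    "X \<in> carrier_mat n k"
  shows "(frob_norm (M * X))\<^sup>2 = (\<Sum>j<k. \<Sum>a<\<rho>. (col X j $ \<omega> a)\<^sup>2)"
proof -
  have "M * X \<in> carrier_mat \<rho> k"
    by (rule mult_carrier_mat[OF _ assms(3)]) (simp add: assms(1))
  moreover have "(M * X) $$ (a,j) = col X j $ \<omega> a" if "a < \<rho>" "j < k" for a j
    using row_subsampling_mult_index[OF assms that] assms that by auto
  ultimately show ?thesis
    by (simp add: frob_norm_cols del: index_mult_mat)
qed

lemma frob_norm_sum_cols:
  assumes "X \<in> carrier_mat n k"
  shows "(frob_norm X)\<^sup>2 = (\<Sum>j<k. \<Sum>i<n. (col X j $ i)\<^sup>2)"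
  using assms by (simp add: frob_norm_cols)

text \<open>The hypothesis is the restricted isometry tested on the outer product of \<open>x\<close> with the
  constant vector. An empty sample on either side makes its right-hand side zero (x / 0 = 0) and
  therefore forces \<open>x = 0\<close>.\<close>

lemma subsampling_lower_bound:
  assumes M: "M = mat \<rho> p (\<lambda>(i,j). if j = \<omega> i then 1 else (0::real))" "\<omega> ` {..<\<rho>} \<subseteq> {..<p}"
    and outer: "\<And>x. x \<in> mat_span A \<Longrightarrow> a * ((\<Sum>i<p. (x $ i)\<^sup>2) * real n)
        \<le> real n * real p / (real \<rho> * real \<sigma>) * ((\<Sum>i<\<rho>. (x $ \<omega> i)\<^sup>2) * real \<sigma>)"
    and n: "0 < n" and a: "0 < a"
    and X: "X \<in> carrier_mat p k" "cols_in_span X A"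
  shows "a * (frob_norm X)\<^sup>2 \<le> real p / real \<rho> * (frob_norm (M * X))\<^sup>2"
proof -
  \<comment> \<open>Here \<open>b\<close> and \<open>c\<close> stand for the squared norms of a
    vector before and after sampling. For nonempty samples the factor \<open>real \<sigma>\<close>
    of the constant vector cancels against the normalisation, and \<open>real n\<close> cancels from
    both sides.\<close>
  have vec: "a * b \<le> real p / real \<rho> * c"
    if h: "a * (b * real n) \<le> real n * real p / (real \<rho> * real \<sigma>) * (c * real \<sigma>)" and c: "0 \<le> c"
    for b c
  proof (cases "\<sigma> = 0 \<or> \<rho> = 0")
    case True
    then have "a * b * real n \<le> 0"
      using h by (elim disjE) (simp_all only: mult.assoc of_nat_0 mult_zero_left mult_zero_right div_by_0)
    then have "a * b \<le> 0"
      using n by (simp add: mult_le_0_iff)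
    also have "0 \<le> real p / real \<rho> * c"
      using c by simp
    finally show ?thesis .
  next
    case False
    then have "a * b * real n \<le> (real p / real \<rho> * c) * real n"
      using h by (simp add: mult_ac)
    then show ?thesis
      by (rule mult_right_le_imp_le) (use n in simp)
  qed
  have "a * (\<Sum>i<p. (col X j $ i)\<^sup>2) \<le> real p / real \<rho> * (\<Sum>i<\<rho>. (col X j $ \<omega> i)\<^sup>2)"
    if "j < k" for j
    using X that by (intro vec outer sum_nonneg) (auto simp: cols_in_span_def cols_def)
  then show ?thesis
    unfolding frob_norm_sum_cols[OF X(1)] frob_norm_subsampled_cols[OF M X(1)] sum_distrib_left
    by (intro sum_mono) (auto simp: sum_distrib_left)
qed

section \<open>Assembling the bounds for both factors\<close>

theorem theorem4:
  fixes n p k kc kr \<rho>c \<rho>r :: nat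
    and \<delta> \<gamma>r \<gamma>c :: real
    and Lc Lr Q P \<Lambda>c \<Lambda>r Qk Pk Mc Mr :: "real mat"
    and Ubar Vbar Eu Ev Utilde Vtilde Ustar Vstar Ustarbar Vstarbar Eustar Evstar :: "real mat"
  assumes lap_c: "graph_laplacian n Lc" and lap_r: "graph_laplacian p Lr"
    and eig_c: "sorted_eigendecomp n Lc Q \<Lambda>c" and eig_r: "sorted_eigendecomp p Lr P \<Lambda>r"
    and kc: "1 \<le> kc" "kc < n" and kr: "1 \<le> kr" "kr < p" and k: "1 \<le> k"
    and Qk: "Qk = first_cols kc Q" and Pk: "Pk = first_cols kr P"
    and delta: "0 < \<delta>" "\<delta> < 1"
    and Mr: "row_subsampling p \<rho>r Mr" and Mc: "col_subsampling n \<rho>c Mc"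
    and rip: "\<forall>Y \<in> LR Pk Qk.
        (1 - \<delta>) * (frob_norm Y)\<^sup>2
          \<le> (real n * real p) / (real \<rho>r * real \<rho>c) * (frob_norm (Mr * Y * Mc))\<^sup>2 \<and>
        (real n * real p) / (real \<rho>r * real \<rho>c) * (frob_norm (Mr * Y * Mc))\<^sup>2
          \<le> (1 + \<delta>) * (frob_norm Y)\<^sup>2"
    and gamma: "0 < \<gamma>r" "0 < \<gamma>c"
    and gap: "0 < eigval \<Lambda>r (kr + 1)" "0 < eigval \<Lambda>c (kc + 1)"
    and Ubar: "Ubar \<in> carrier_mat p k" "cols_in_span Ubar Pk"
    and Vbar: "Vbar \<in> carrier_mat n k" "cols_in_span Vbar Qk"
    and Eu: "Eu \<in> carrier_mat \<rho>r k" and Ev: "Ev \<in> carrier_mat \<rho>c k"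
    and Utilde: "Utilde = Mr * Ubar + Eu" and Vtilde: "Vtilde = Mc\<^sup>T * Vbar + Ev"
    and Ustar: "is_arg_min (graph_decoder_objective Mr Utilde \<gamma>r Lr) (\<lambda>U. U \<in> carrier_mat p k) Ustar"
    and Vstar: "is_arg_min (graph_decoder_objective Mc\<^sup>T Vtilde \<gamma>c Lc) (\<lambda>V. V \<in> carrier_mat n k) Vstar"
    and Ustarbar: "Ustarbar = Pk * Pk\<^sup>T * Ustar" and Eustar: "Eustar = Ustar - Ustarbar"
    and Vstarbar: "Vstarbar = Qk * Qk\<^sup>T * Vstar" and Evstar: "Evstar = Vstar - Vstarbar"
  shows
    "frob_norm (Ustarbar - Ubar)
       \<le> sqrt (2 * real p / (real \<rho>r * (1 - \<delta>))) *
          ((2 + 1 / sqrt (\<gamma>r * eigval \<Lambda>r (kr + 1))) * frob_norm Eu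
           + (sqrt (eigval \<Lambda>r kr / eigval \<Lambda>r (kr + 1)) + sqrt (\<gamma>r * eigval \<Lambda>r kr)) * frob_norm Ubar)
     \<and> frob_norm Eustar
       \<le> sqrt (2 / (\<gamma>r * eigval \<Lambda>r (kr + 1))) * frob_norm Eu
          + sqrt (2 * (eigval \<Lambda>r kr / eigval \<Lambda>r (kr + 1))) * frob_norm Ubar
     \<and> frob_norm (Vstarbar - Vbar)
       \<le> sqrt (2 * real n / (real \<rho>c * (1 - \<delta>))) *
          ((2 + 1 / sqrt (\<gamma>c * eigval \<Lambda>c (kc + 1))) * frob_norm Ev
           + (sqrt (eigval \<Lambda>c kc / eigval \<Lambda>c (kc + 1)) + sqrt (\<gamma>c * eigval \<Lambda>c kc)) * frob_norm Vbar)
     \<and> frob_norm Evstar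
       \<le> sqrt (2 / (\<gamma>c * eigval \<Lambda>c (kc + 1))) * frob_norm Ev
          + sqrt (2 * (eigval \<Lambda>c kc / eigval \<Lambda>c (kc + 1))) * frob_norm Vbar"
proof -
  have rowM: "row_subsampling n \<rho>c Mc\<^sup>T"
    by (rule row_subsampling_transpose[OF Mc])
  obtain \<omega>r where wr: "\<omega>r ` {..<\<rho>r} \<subseteq> {..<p}"
    and Mr_eq: "Mr = mat \<rho>r p (\<lambda>(i,j). if j = \<omega>r i then 1 else 0)"
    using Mr by (auto simp: row_subsampling_def)
  obtain \<omega>c where wc: "\<omega>c ` {..<\<rho>c} \<subseteq> {..<n}"
    and Mc_eq: "Mc = mat n \<rho>c (\<lambda>(i,j). if i = \<omega>c j then 1 else 0)"
    using Mc by (auto simp: col_subsampling_def)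
  have McT_eq: "Mc\<^sup>T = mat \<rho>c n (\<lambda>(i,j). if j = \<omega>c i then 1 else 0)"
    unfolding Mc_eq by (intro eq_matI) auto
  have Pk_carrier: "Pk \<in> carrier_mat p kr"
    using eig_r kr unfolding Pk
    by (auto simp: sorted_eigendecomp_def orthonormal_mat_def first_cols_eq_mat)
  have Qk_carrier: "Qk \<in> carrier_mat n kc"
    using eig_c kc unfolding Qk
    by (auto simp: sorted_eigendecomp_def orthonormal_mat_def first_cols_eq_mat)
  have ones_r: "vec p (\<lambda>_. 1) \<in> mat_span Pk"
    unfolding Pk by (rule ones_in_low_eigenspace[OF lap_r eig_r kr(2) gap(1)])
  have ones_c: "vec n (\<lambda>_. 1) \<in> mat_span Qk"
    unfolding Qk by (rule ones_in_low_eigenspace[OF lap_c eig_c kc(2) gap(2)])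
  \<comment> \<open>Both test vectors stay free: the bound for \<open>U\<close> takes
    \<open>y\<close> constant, the bound for \<open>V\<close> takes \<open>x\<close>
    constant.\<close>
  have outer: "(1 - \<delta>) * ((\<Sum>i<p. (x $ i)\<^sup>2) * (\<Sum>j<n. (y $ j)\<^sup>2))
      \<le> real n * real p / (real \<rho>r * real \<rho>c) * ((\<Sum>i<\<rho>r. (x $ \<omega>r i)\<^sup>2) * (\<Sum>j<\<rho>c. (y $ \<omega>c j)\<^sup>2))"
    if "x \<in> mat_span Pk" "y \<in> mat_span Qk" for x y
    by (rule rip_outer_product[OF Pk_carrier Qk_carrier that Mr_eq wr Mc_eq wc]) (use rip in blast)
  \<comment> \<open>The entries of the constant vector are known only inside its dimension, and
    \<open>wr\<close> keeps the sampled indices there.\<close>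
  have sum_r: "(\<Sum>j<\<rho>r. (vec p (\<lambda>_. 1) $ \<omega>r j)\<^sup>2) = real \<rho>r"
  proof -
    have "(\<Sum>j<\<rho>r. (vec p (\<lambda>_. 1) $ \<omega>r j)\<^sup>2) = (\<Sum>j<\<rho>r. 1 :: real)"
      using wr by (intro sum.cong) auto
    then show ?thesis by simp
  qed
  have sum_c: "(\<Sum>j<\<rho>c. (vec n (\<lambda>_. 1) $ \<omega>c j)\<^sup>2) = real \<rho>c"
  proof -
    have "(\<Sum>j<\<rho>c. (vec n (\<lambda>_. 1) $ \<omega>c j)\<^sup>2) = (\<Sum>j<\<rho>c. 1 :: real)"
      using wc by (intro sum.cong) auto
    then show ?thesis by simp
  qed
  have np: "0 < n" "0 < p" and d: "0 < 1 - \<delta>"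
    using kc kr delta by auto
  have low_r: "(1 - \<delta>) * (frob_norm X)\<^sup>2 \<le> real p / real \<rho>r * (frob_norm (Mr * X))\<^sup>2"
    if "X \<in> carrier_mat p k" "cols_in_span X Pk" for X
  proof (rule subsampling_lower_bound[OF Mr_eq wr _ np(1) d that])
    fix x assume "x \<in> mat_span Pk"
    from outer[OF this ones_c]
    show "(1 - \<delta>) * ((\<Sum>i<p. (x $ i)\<^sup>2) * real n)
        \<le> real n * real p / (real \<rho>r * real \<rho>c) * ((\<Sum>i<\<rho>r. (x $ \<omega>r i)\<^sup>2) * real \<rho>c)"
      unfolding sum_c by simp
  qed
  have low_c: "(1 - \<delta>) * (frob_norm X)\<^sup>2 \<le> real n / real \<rho>c * (frob_norm (Mc\<^sup>T * X))\<^sup>2"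
    if "X \<in> carrier_mat n k" "cols_in_span X Qk" for X
  proof (rule subsampling_lower_bound[OF McT_eq wc _ np(2) d that])
    \<comment> \<open>Rows and columns exchange roles: the constant vector now comes from the row
      graph, and the products are commuted accordingly.\<close>
    fix y assume "y \<in> mat_span Qk"
    from outer[OF ones_r this]
    show "(1 - \<delta>) * ((\<Sum>i<n. (y $ i)\<^sup>2) * real p)
        \<le> real p * real n / (real \<rho>c * real \<rho>r) * ((\<Sum>i<\<rho>c. (y $ \<omega>c i)\<^sup>2) * real \<rho>r)"
      unfolding sum_r by (simp add: mult.commute)
  qed
  show ?thesis
    using decoder_error_bounds[OF lap_r eig_r kr Pk delta(2) Mr low_r gamma(1) gap(1) Ubar Eu Utilde
        Ustar Ustarbar Eustar]
      decoder_error_bounds[OF lap_c eig_c kc Qk delta(2) rowM low_c gamma(2) gap(2) Vbar Ev Vtilde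
        Vstar Vstarbar Evstar]
    by simp
qed

end
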